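(* Let $(M,\mathcal{T})$ be a triangulated closed 3-manifold such that $d_i\leq 22$ for all $i\in\mathcal{T}_0$. Then there exists no ball packing $\pmb{r}\in\mathbb{R}^N_+$, real or virtual, such that $\widetilde{\pmb{K}}(\pmb{r})=\pmb{0}$. Moreover, for any initial data $\pmb{r}(0)\in\mathbb{R}^N_+$, the solution $\pmb{r}(t)$ of the extended combinatorial Yamabe flow $$\frac{dr_i}{dt}=-\widetilde{K}_i\sinh r_i,\qquad i\in\mathcal{T}_0,$$ satisfies $\pmb{r}(t)\to\pmb{0}$ as $t\to\infty$.
   Context: $M$ is a closed 3-manifold with a (finite) triangulation $\mathcal{T}=\{\mathcal{T}_0,\mathcal{T}_1,\mathcal{T}_2,\mathcal{T}_3\}$ (vertices, edges, faces, tetrahedra), $\mathcal{T}_0=\{1,\dots,N\}$; $\{ijkl\}\in\mathcal{T}_3$ denotes the tetrahedron with vertices $i,j,k,l$. The tetra-degree $d_i$ is the number of tetrahedra incident to the vertex $i$. $\mathbb{R}_+=(0,\infty)$. A (hyperbolic) ball packing is a vector $\pmb{r}=(r_1,\dots,r_N)\in\mathbb{R}^N_+$. For $(r_i,r_j,r_k,r_l)\in\mathbb{R}_+^4$ write $y_a=\coth r_a$ and $Q=(y_i+y_j+y_k+y_l)^2-2(y_i^2+y_j^2+y_k^2+y_l^2)+4$. A non-degenerate tetrahedron in $\mathbb{H}^3$ (curvature $-1$) with edge lengths $l_{ab}=r_a+r_b$ exists iff $Q>0$ and is then unique up to isometry; in this case the tetrahedron is called real, otherwise virtual. A ball packing is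 real if all tetrahedra of $\mathcal{T}_3$ are real, and virtual otherwise. For a real tetrahedron $\alpha_{ijkl}$ is its solid angle at $i$ (sum of the three dihedral angles at the edges through $i$, minus $\pi$). The set $\{Q\le 0\}\subset\mathbb{R}_+^4$ is the disjoint union of the four sets $D_a$, $a\in\{i,j,k,l\}$, where $D_a=\{y_a\geq y_b+y_c+y_d+2(y_by_c+y_cy_d+y_dy_b+1)^{1/2}\}$ with $\{a,b,c,d\}=\{i,j,k,l\}$. The extended solid angle at $i$ is $\widetilde\alpha_{ijkl}=\alpha_{ijkl}$ if $Q>0$, $\widetilde\alpha_{ijkl}=2\pi$ on $D_i$, and $\widetilde\alpha_{ijkl}=0$ on $D_j\cup D_k\cup D_l$. The extended combinatorial scalar curvature is $\widetilde{K}_i=4\pi-\sum\widetilde{\alpha}_{ijkl}$, summed over all tetrahedra incident to $i$, and $\widetilde{\pmb K}=(\widetilde K_1,\dots,\widetilde K_N)$. For every initial data in $\mathbb{R}^N_+$ the extended flow has a unique solution in $\mathbb{R}^N_+$, defined for all $t\in[0,\infty)$. *)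

theory Defs
  imports "HOL-Analysis.Analysis"
begin

section \<open>Triangulated closed 3-manifolds\<close>

definition closed_3_manifold :: "'a topology \<Rightarrow> bool" where
  "closed_3_manifold M \<longleftrightarrow>
     topspace M \<noteq> {} \<and> compact_space M \<and> Hausdorff_space M \<and> second_countable M \<and>
     (\<forall>x\<in>topspace M. \<exists>U V. openin M U \<and> x \<in> U \<and> openin (Euclidean_space 3) V \<and>
        subtopology M U homeomorphic_space subtopology (Euclidean_space 3) V)"

text \<open>Geometric realization of a finite abstract simplicial complex with vertices in
  \<open>{1..N}\<close>, in barycentric coordinates: a point is a convex combination of vertices whose
  support is a simplex.\<close>

definition realization :: "nat \<Rightarrow> nat set set \<Rightarrow> (nat \<Rightarrow> real) topology" where
  "realization N T = subtopology (powertop_real UNIV)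
     {x. (\<forall>i. 0 \<le> x i) \<and> {i. x i \<noteq> 0} \<in> T \<and> (\<Sum>i=1..N. x i) = 1}"

definition triangulates :: "nat \<Rightarrow> nat set set \<Rightarrow> 'a topology \<Rightarrow> bool" where
  "triangulates N T M \<longleftrightarrow>
     {} \<notin> T \<and> \<Union>T = {1..N} \<and>
     (\<forall>\<sigma>\<in>T. card \<sigma> \<le> 4) \<and>
     (\<forall>\<sigma>\<in>T. \<forall>\<tau>. \<tau> \<subseteq> \<sigma> \<and> \<tau> \<noteq> {} \<longrightarrow> \<tau> \<in> T) \<and>
     realization N T homeomorphic_space M"

definition tetrahedra :: "nat set set \<Rightarrow> nat set set" where
  "tetrahedra T = {\<sigma>\<in>T. card \<sigma> = 4}"

definition tetra_degree :: "nat set set \<Rightarrow> nat \<Rightarrow> nat" where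
  "tetra_degree T i = card {\<sigma>\<in>tetrahedra T. i \<in> \<sigma>}"


section \<open>Tetrahedra in hyperbolic 3-space\<close>

text \<open>Hyperboloid model: \<open>\<real>\<times>\<real>\<^sup>3\<close> carries the Minkowski form with negative time direction
  given by the first component.\<close>

type_synonym minkowski = "real \<times> (real^3)"

definition mink :: "minkowski \<Rightarrow> minkowski \<Rightarrow> real" where
  "mink p q = snd p \<bullet> snd q - fst p * fst q"

definition H3 :: "minkowski set" where
  "H3 = {p. mink p p = - 1 \<and> 0 < fst p}"

definition hdist :: "minkowski \<Rightarrow> minkowski \<Rightarrow> real" where
  "hdist p q = arcosh (- mink p q)"

text \<open>Component of \<open>v\<close> orthogonal to \<open>w\<close>. For \<open>p, q \<in> H3\<close> the vector \<open>perp p q\<close> is the tangent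
  vector at \<open>p\<close> pointing towards \<open>q\<close> along the geodesic. On the tangent space at \<open>p\<close> the
  form \<open>mink\<close> is the (positive definite) Riemannian metric.\<close>

definition perp :: "minkowski \<Rightarrow> minkowski \<Rightarrow> minkowski" where
  "perp w v = v - (mink v w / mink w w) *\<^sub>R w"

definition mink_angle :: "minkowski \<Rightarrow> minkowski \<Rightarrow> real" where
  "mink_angle v w = arccos (mink v w / (sqrt (mink v v) * sqrt (mink w w)))"

text \<open>Dihedral angle at the edge \<open>pq\<close> between the faces \<open>pqu\<close> and \<open>pqv\<close>: the angle, in the plane
  of the tangent space at \<open>p\<close> normal to the edge, between the directions of the two faces.\<close>

definition dihedral :: "minkowski \<Rightarrow> minkowski \<Rightarrow> minkowski \<Rightarrow> minkowski \<Rightarrow> real" where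
  "dihedral p q u v =
     mink_angle (perp (perp p q) (perp p u)) (perp (perp p q) (perp p v))"

definition solid_angle_at :: "minkowski \<Rightarrow> minkowski \<Rightarrow> minkowski \<Rightarrow> minkowski \<Rightarrow> real" where
  "solid_angle_at p q u v = dihedral p q u v + dihedral p u q v + dihedral p v q u - pi"

text \<open>Vertices of a non-degenerate tetrahedron (not contained in a hyperbolic plane, i.e. linearly
  independent) whose edge lengths are the sums of the radii.\<close>

definition ball_tetrahedron ::
  "real \<Rightarrow> real \<Rightarrow> real \<Rightarrow> real \<Rightarrow> minkowski \<times> minkowski \<times> minkowski \<times> minkowski \<Rightarrow> bool" where
  "ball_tetrahedron a b c d = (\<lambda>(p, q, u, v).
     {p, q, u, v} \<subseteq> H3 \<and> card {p, q, u, v} = 4 \<and> independent {p, q, u, v} \<and>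
     hdist p q = a + b \<and> hdist p u = a + c \<and> hdist p v = a + d \<and>
     hdist q u = b + c \<and> hdist q v = b + d \<and> hdist u v = c + d)"

text \<open>Solid angle at the vertex of the ball of radius \<open>a\<close>; the choice of the tetrahedron is
  immaterial, since it is unique up to isometry. Meaningful only if such a tetrahedron exists.\<close>

definition solid_angle :: "real \<Rightarrow> real \<Rightarrow> real \<Rightarrow> real \<Rightarrow> real" where
  "solid_angle a b c d =
     (case (SOME P. ball_tetrahedron a b c d P) of (p, q, u, v) \<Rightarrow> solid_angle_at p q u v)"


section \<open>Extended curvature and extended flow\<close>

definition coth :: "real \<Rightarrow> real" where
  "coth x = cosh x / sinh x"

definition Qform :: "real \<Rightarrow> real \<Rightarrow> real \<Rightarrow> real \<Rightarrow> real" where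
  "Qform a b c d = (coth a + coth b + coth c + coth d)\<^sup>2
     - 2 * ((coth a)\<^sup>2 + (coth b)\<^sup>2 + (coth c)\<^sup>2 + (coth d)\<^sup>2) + 4"

definition in_D :: "real \<Rightarrow> real \<Rightarrow> real \<Rightarrow> real \<Rightarrow> bool" where
  "in_D a b c d \<longleftrightarrow> coth a \<ge> coth b + coth c + coth d
     + 2 * sqrt (coth b * coth c + coth c * coth d + coth d * coth b + 1)"

text \<open>For positive radii \<open>{Q \<le> 0}\<close> is the disjoint union of the four sets \<open>D\<close>, so the last
  case covers exactly the other three of them.\<close>

definition ext_solid_angle :: "real \<Rightarrow> real \<Rightarrow> real \<Rightarrow> real \<Rightarrow> real" where
  "ext_solid_angle a b c d =
     (if Qform a b c d > 0 then solid_angle a b c d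
      else if in_D a b c d then 2 * pi else 0)"

text \<open>A tetrahedron incident to \<open>i\<close> is indexed by its three other vertices \<open>j < k < l\<close>.\<close>

definition ext_curvature :: "nat set set \<Rightarrow> (nat \<Rightarrow> real) \<Rightarrow> nat \<Rightarrow> real" where
  "ext_curvature T r i = 4 * pi -
     (\<Sum>(j, k, l) \<in> {(j, k, l). j < k \<and> k < l \<and> {i, j, k, l} \<in> tetrahedra T}.
        ext_solid_angle (r i) (r j) (r k) (r l))"

definition ball_packing :: "nat \<Rightarrow> (nat \<Rightarrow> real) \<Rightarrow> bool" where
  "ball_packing N r \<longleftrightarrow> (\<forall>i\<in>{1..N}. 0 < r i)"

definition ext_Yamabe_solution :: "nat \<Rightarrow> nat set set \<Rightarrow> (real \<Rightarrow> nat \<Rightarrow> real) \<Rightarrow> bool" where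
  "ext_Yamabe_solution N T r \<longleftrightarrow>
     (\<forall>t\<ge>0. ball_packing N (r t)) \<and>
     (\<forall>t\<ge>0. \<forall>i\<in>{1..N}.
        ((\<lambda>s. r s i) has_real_derivative - ext_curvature T (r t) i * sinh (r t i))
          (at t within {0..}))"

end

theory Submission
  imports Defs
begin

text \<open>The solid angle at a vertex is the excess \<open>E\<close> of the spherical triangle cut out by the
  tetrahedron, and \<open>tan (E / 2)\<close> is the square root of the Gram determinant over
  \<open>1 + cos A + cos B + cos C\<close>, where \<open>A, B, C\<close> are the face angles at the vertex.
  For ball tetrahedra these cosines are \<open>1 - 2 / (V W)\<close>, \<open>1 - 2 / (U W)\<close>, \<open>1 - 2 / (U V)\<close> with
  \<open>U = (coth a + coth b) / \<surd>((coth a)\<^sup>2 - 1)\<close> and similarly \<open>V, W\<close>. At a vertex carrying the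
  largest radius all three are at least \<open>2\<close>, the value for the regular Euclidean tetrahedron,
  where \<open>tan (E / 2) = \<surd>2 / 5\<close> is maximal. Hence the extended solid angle there is at most
  \<open>2 \<surd>2 / 5\<close>, and since \<open>22 \<cdot> 2 \<surd>2 / 5 < 4 \<pi>\<close>, the extended curvature at a vertex of largest
  radius is bounded below by a positive constant. It therefore never vanishes there, and the
  maximum principle makes the largest radius decay exponentially along the flow.\<close>

section \<open>The excess of a spherical triangle\<close>

text \<open>Spherical law of cosines: the arguments are the cosines of the three sides, and the
  value is the angle opposite the first side.\<close>

definition spherical_angle :: "real \<Rightarrow> real \<Rightarrow> real \<Rightarrow> real" where
  "spherical_angle A B C = arccos ((A - B * C) / (sqrt (1 - B\<^sup>2) * sqrt (1 - C\<^sup>2)))"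

text \<open>Gram determinant of three unit vectors with pairwise inner products \<open>A\<close>,
  \<open>B\<close>, \<open>C\<close>.\<close>

definition gram :: "real \<Rightarrow> real \<Rightarrow> real \<Rightarrow> real" where
  "gram A B C = 1 - A\<^sup>2 - B\<^sup>2 - C\<^sup>2 + 2 * A * B * C"

lemma gram_commute: "gram B A C = gram A B C" "gram A C B = gram A B C"
  by (simp_all add: gram_def algebra_simps)

lemma one_minus_square_pos:
  fixes x :: real
  assumes "\<bar>x\<bar> < 1"
  shows "0 < 1 - x\<^sup>2"
  using assms by (simp add: abs_square_less_1)

text \<open>The identity \<open>(1 - B\<^sup>2) * (1 - C\<^sup>2) - (A - B * C)\<^sup>2 = gram A B
  C\<close> keeps the quotient in the domain of \<open>arccos\<close> and yields the sine of the
  angle.\<close>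

lemma spherical_cosine:
  fixes A B C :: real
  assumes "\<bar>B\<bar> < 1" "\<bar>C\<bar> < 1" "gram A B C \<ge> 0"
  defines "n \<equiv> sqrt (1 - B\<^sup>2) * sqrt (1 - C\<^sup>2)"
  shows "\<bar>(A - B * C) / n\<bar> \<le> 1" "sqrt (1 - ((A - B * C) / n)\<^sup>2) = sqrt (gram A B C) / n"
proof -
  define x where "x = (A - B * C) / n"
  have pos: "0 < 1 - B\<^sup>2" "0 < 1 - C\<^sup>2"
    using assms one_minus_square_pos by auto
  then have n: "n > 0" "n\<^sup>2 = (1 - B\<^sup>2) * (1 - C\<^sup>2)"
    by (simp_all add: n_def power_mult_distrib)
  have "n\<^sup>2 - (A - B * C)\<^sup>2 = gram A B C"
    unfolding n(2) gram_def by algebra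
  moreover have "x\<^sup>2 = (A - B * C)\<^sup>2 / n\<^sup>2"
    by (simp add: x_def power_divide)
  ultimately have x2: "1 - x\<^sup>2 = gram A B C / n\<^sup>2"
    using n(1) by (metis diff_divide_distrib divide_self less_irrefl power_not_zero)
  then have "x\<^sup>2 \<le> 1"
    using assms(3) by (smt (verit) divide_nonneg_nonneg zero_le_power2)
  then have "\<bar>x\<bar> \<le> 1"
    by (simp add: abs_square_le_1)
  moreover have "sqrt (1 - x\<^sup>2) = sqrt (gram A B C) / n"
    using n(1) by (simp add: x2 real_sqrt_divide)
  ultimately show "\<bar>(A - B * C) / n\<bar> \<le> 1"
      "sqrt (1 - ((A - B * C) / n)\<^sup>2) = sqrt (gram A B C) / n"
    unfolding x_def .
qed

text \<open>The imaginary part of the numerator is symmetric in the sides, hence common to all three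
  angles. This is what makes the product of the three numbers tractable.\<close>

lemma cis_spherical_angle:
  assumes "\<bar>B\<bar> < 1" "\<bar>C\<bar> < 1" "gram A B C \<ge> 0"
  shows "cis (spherical_angle A B C) =
    Complex (A - B * C) (sqrt (gram A B C)) / of_real (sqrt (1 - B\<^sup>2) * sqrt (1 - C\<^sup>2))"
proof -
  note cosine = spherical_cosine[OF assms]
  then have "cos (spherical_angle A B C) = (A - B * C) / (sqrt (1 - B\<^sup>2) * sqrt (1 - C\<^sup>2))"
    unfolding spherical_angle_def by (intro cos_arccos) (simp_all only: abs_le_iff, linarith+)
  moreover have "sin (spherical_angle A B C) =
      sqrt (gram A B C) / (sqrt (1 - B\<^sup>2) * sqrt (1 - C\<^sup>2))"
    unfolding spherical_angle_def cosine(2)[symmetric]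
    using cosine(1) by (intro sin_arccos) (simp_all only: abs_le_iff, linarith+)
  ultimately show ?thesis
    by (simp add: complex_eq_iff flip: of_real_mult)
qed

lemma spherical_angle_le_pi:
  assumes "\<bar>B\<bar> < 1" "\<bar>C\<bar> < 1" "gram A B C \<ge> 0"
  shows "spherical_angle A B C \<le> pi"
  unfolding spherical_angle_def
  using spherical_cosine(1)[OF assms] by (intro arccos_ubound) (simp_all only: abs_le_iff, linarith+)

text \<open>The complex number \<open>1 + A + B + C + i \<surd>gram\<close> has half the spherical excess as its
  argument: up to a positive factor its square is minus the product of the three numbers
  representing the angles.\<close>

lemma spherical_excess_le:
  assumes "\<bar>A\<bar> < 1" "\<bar>B\<bar> < 1" "\<bar>C\<bar> < 1" "gram A B C > 0" "1 + A + B + C > 0"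
  shows "spherical_angle A B C + spherical_angle B A C + spherical_angle C A B - pi
    \<le> 2 * arctan (sqrt (gram A B C) / (1 + A + B + C))"
proof -
  define d where "d = sqrt (gram A B C)"
  define k where "k = 1 + A + B + C"
  define \<phi> where "\<phi> = arctan (d / k)"
  define S where "S = spherical_angle A B C + spherical_angle B A C + spherical_angle C A B"
  define m where "m = (1 - A\<^sup>2) * (1 - B\<^sup>2) * (1 - C\<^sup>2)"
  have d: "d > 0" "d\<^sup>2 = gram A B C" and k: "k > 0"
    using assms by (simp_all add: d_def k_def)
  have pos: "0 < 1 - A\<^sup>2" "0 < 1 - B\<^sup>2" "0 < 1 - C\<^sup>2"
    using assms one_minus_square_pos by auto
  have "cis S = Complex (A - B * C) d / of_real (sqrt (1 - B\<^sup>2) * sqrt (1 - C\<^sup>2)) *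
      (Complex (B - A * C) d / of_real (sqrt (1 - A\<^sup>2) * sqrt (1 - C\<^sup>2))) *
      (Complex (C - A * B) d / of_real (sqrt (1 - A\<^sup>2) * sqrt (1 - B\<^sup>2)))"
    using assms cis_spherical_angle[of B C A] cis_spherical_angle[of A C B]
      cis_spherical_angle[of A B C]
    by (simp add: S_def cis_mult[symmetric] gram_commute d_def)
  also have "\<dots> = Complex (A - B * C) d * Complex (B - A * C) d * Complex (C - A * B) d /
      of_real ((sqrt (1 - A\<^sup>2))\<^sup>2 * (sqrt (1 - B\<^sup>2))\<^sup>2 * (sqrt (1 - C\<^sup>2))\<^sup>2)"
    by (simp only: of_real_mult times_divide_times_eq power2_eq_square mult_ac)
  also have "(sqrt (1 - A\<^sup>2))\<^sup>2 * (sqrt (1 - B\<^sup>2))\<^sup>2 * (sqrt (1 - C\<^sup>2))\<^sup>2 = m"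
    using pos by (simp add: m_def)
  also have "Complex (A - B * C) d * Complex (B - A * C) d * Complex (C - A * B) d =
      - of_real ((1 - A) * (1 - B) * (1 - C) / 2) * (Complex k d)\<^sup>2"
  proof -
    have "(A - B * C) * (B - A * C) * (C - A * B)
        - d\<^sup>2 * ((A - B * C) + (B - A * C) + (C - A * B)) =
        - ((1 - A) * (1 - B) * (1 - C) / 2) * (k\<^sup>2 - d\<^sup>2)"
      unfolding d(2) gram_def k_def by (simp add: field_simps) algebra
    moreover have "d * ((A - B * C) * (B - A * C) + (B - A * C) * (C - A * B)
        + (C - A * B) * (A - B * C) - d\<^sup>2) =
        d * (- ((1 - A) * (1 - B) * (1 - C)) * k)"
      unfolding d(2) gram_def k_def by algebra
    moreover have "Complex (A - B * C) d * Complex (B - A * C) d * Complex (C - A * B) d =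
        Complex ((A - B * C) * (B - A * C) * (C - A * B)
            - d\<^sup>2 * ((A - B * C) + (B - A * C) + (C - A * B)))
          (d * ((A - B * C) * (B - A * C) + (B - A * C) * (C - A * B)
            + (C - A * B) * (A - B * C) - d\<^sup>2))"
      by (simp add: complex_eq_iff power2_eq_square algebra_simps)
    ultimately show ?thesis
      by (simp add: complex_eq_iff power2_eq_square)
  qed
  \<comment> \<open>Since \<open>k > 0\<close>, the number lies in the right half plane, so
    \<open>arctan (d / k)\<close> is its argument.\<close>
  also have "Complex k d = of_real (sqrt (k\<^sup>2 + d\<^sup>2)) * cis \<phi>"
  proof -
    have "sqrt (1 + (d / k)\<^sup>2) = sqrt ((k\<^sup>2 + d\<^sup>2) / k\<^sup>2)"
      using k by (simp add: field_simps)
    also have "\<dots> = sqrt (k\<^sup>2 + d\<^sup>2) / k"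
      using k by (simp add: real_sqrt_divide)
    finally have "cos \<phi> = k / sqrt (k\<^sup>2 + d\<^sup>2)" "sin \<phi> = d / sqrt (k\<^sup>2 + d\<^sup>2)"
      using k by (simp_all add: \<phi>_def cos_arctan sin_arctan)
    moreover have "sqrt (k\<^sup>2 + d\<^sup>2) > 0"
      using k by (simp add: sum_power2_gt_zero_iff)
    ultimately show ?thesis
      by (simp add: complex_eq_iff)
  qed
  also have "- of_real ((1 - A) * (1 - B) * (1 - C) / 2)
        * (of_real (sqrt (k\<^sup>2 + d\<^sup>2)) * cis \<phi>)\<^sup>2 / of_real m
      = of_real ((1 - A) * (1 - B) * (1 - C) / 2 * (k\<^sup>2 + d\<^sup>2) / m) * (- cis (2 * \<phi>))"
  proof -
    have "(of_real (sqrt (k\<^sup>2 + d\<^sup>2)) :: complex)\<^sup>2 = of_real (k\<^sup>2 + d\<^sup>2)"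
      by (simp del: of_real_add flip: of_real_power)
    moreover have "(cis \<phi>)\<^sup>2 = cis (2 * \<phi>)"
      by (simp add: power2_eq_square cis_mult)
    ultimately show ?thesis
      by (simp add: power_mult_distrib)
  qed
  also have "(1 - A) * (1 - B) * (1 - C) / 2 * (k\<^sup>2 + d\<^sup>2) / m = 1"
  proof -
    \<comment> \<open>This amounts to
      \<open>k\<^sup>2 + d\<^sup>2 = 2 * (1 + A) * (1 + B) * (1 + C)\<close>.\<close>
    have "(1 - A) * (1 - B) * (1 - C) / 2 * (k\<^sup>2 + d\<^sup>2) = m"
      unfolding d(2) gram_def k_def m_def by (simp add: field_simps) algebra
    then show ?thesis
      using pos by (simp add: m_def)
  qed
  also have "- cis (2 * \<phi>) = cis (2 * \<phi> + pi)"
    by (rule minus_cis)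
  finally have "cis S = cis (2 * \<phi> + pi)"
    by simp
  then have "sin S = sin (2 * \<phi> + pi) \<and> cos S = cos (2 * \<phi> + pi)"
    by (simp add: complex_eq_iff)
  then obtain n :: int where n: "S = 2 * \<phi> + pi + 2 * pi * n"
    using sin_cos_eq_iff by blast
  \<comment> \<open>The angle sum is known only modulo \<open>2 * pi\<close>. That each angle is at
    most \<open>pi\<close> and that \<phi> is positive rule out \<open>n \<ge> 1\<close>; a negative
    \<open>n\<close> does no harm to an upper bound.\<close>
  have "S \<le> 3 * pi"
    using assms spherical_angle_le_pi[of B C A] spherical_angle_le_pi[of A C B]
      spherical_angle_le_pi[of A B C] by (simp add: S_def gram_commute)
  moreover have "\<phi> > 0"
    using d k by (simp add: \<phi>_def)
  ultimately have "2 * pi * n < 2 * pi * 1"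
    using n by linarith
  then have "n \<le> 0"
    by (simp add: mult_less_cancel_left)
  then have "2 * pi * n \<le> 0"
    by (simp add: mult_nonneg_nonpos)
  then show ?thesis
    using n by (simp add: S_def \<phi>_def d_def k_def)
qed

text \<open>\<open>P\<close> says that the Gram determinant is positive. After cancelling
  \<open>2 / (U * V * W)\<close>, the tangent of half the excess becomes \<open>sqrt R / k\<close>,
  whose value at \<open>U = V = W = 2\<close> is \<open>sqrt 8 / 10 = sqrt 2 / 5\<close>.\<close>

lemma spherical_excess_le_const:
  fixes U V W :: real
  assumes U: "U \<ge> 2" and V: "V \<ge> 2" and W: "W \<ge> 2"
    and P: "2 * (U * V + V * W + W * U) - (U\<^sup>2 + V\<^sup>2 + W\<^sup>2) > 4"
  defines "A \<equiv> 1 - 2 / (V * W)" and "B \<equiv> 1 - 2 / (U * W)" and "C \<equiv> 1 - 2 / (U * V)"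
  shows "\<bar>A\<bar> < 1" "\<bar>B\<bar> < 1" "\<bar>C\<bar> < 1" "gram A B C > 0"
    "spherical_angle A B C + spherical_angle B A C + spherical_angle C A B - pi \<le> 2 * sqrt 2 / 5"
proof -
  define R where "R = 2 * (U * V + V * W + W * U) - (U\<^sup>2 + V\<^sup>2 + W\<^sup>2) - 4"
  have prod: "x * y \<ge> 4" if "x \<ge> 2" "y \<ge> 2" for x y :: real
    using mult_mono[OF that] that by simp
  have ab: "\<bar>1 - 2 / (x * y)\<bar> < 1" if "x \<ge> 2" "y \<ge> 2" for x y :: real
    using prod[OF that] by (simp add: abs_less_iff field_simps)
  show *: "\<bar>A\<bar> < 1" "\<bar>B\<bar> < 1" "\<bar>C\<bar> < 1"
    unfolding A_def B_def C_def using ab U V W by blast+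
  have nz: "U \<noteq> 0" "V \<noteq> 0" "W \<noteq> 0"
    using U V W by auto
  have g: "gram A B C = R * (2 / (U * V * W))\<^sup>2"
    using nz by (simp add: gram_def A_def B_def C_def R_def divide_simps) algebra
  have R: "R > 0"
    using P by (simp add: R_def)
  show "gram A B C > 0"
    using nz R by (simp add: g)
  define k where "k = 2 * U * V * W - (U + V + W)"
  \<comment> \<open>Shifting the extremal point to the origin makes all coefficients of
    \<open>k\<close> nonnegative, so that \<open>25 * R \<le> 2 * k\<^sup>2\<close> can be compared
    term by term.\<close>
  obtain u v w where uvw: "U = 2 + u" "V = 2 + v" "W = 2 + w" "u \<ge> 0" "v \<ge> 0" "w \<ge> 0"
    using U V W by (metis add_diff_cancel_left' diff_add_cancel diff_ge_0_iff_ge add.commute)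
  define e where "e = 7 * (u + v + w) + 4 * (u * v + v * w + w * u) + 2 * u * v * w"
  have e: "e \<ge> 7 * (u + v + w) + 4 * (u * v + v * w + w * u)"
    using uvw by (simp add: e_def)
  have nn: "u * v \<ge> 0" "v * w \<ge> 0" "w * u \<ge> 0"
    using uvw by simp_all
  have k_eq: "k = 10 + e"
    by (simp add: k_def e_def uvw algebra_simps)
  have k: "k > 0"
    unfolding k_eq e_def using nn uvw by (simp add: add_pos_nonneg)
  have "25 * R = 25 * (8 + 4 * (u + v + w) + 2 * (u * v + v * w + w * u) - (u\<^sup>2 + v\<^sup>2 + w\<^sup>2))"
    unfolding R_def uvw by algebra
  also have "\<dots> \<le> 2 * (100 + 20 * e)"
    using e nn uvw zero_le_power2[of u] zero_le_power2[of v] zero_le_power2[of w] by argo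
  also have "\<dots> \<le> 2 * k\<^sup>2"
    by (simp add: k_eq power2_eq_square algebra_simps)
  finally have Rk: "R \<le> 2 * (k / 5)\<^sup>2"
    by (simp add: power_divide)
  have s: "1 + A + B + C = k * (2 / (U * V * W))"
    using nz by (simp add: A_def B_def C_def k_def divide_simps) algebra
  have uvwpos: "2 / (U * V * W) > 0"
    using U V W by simp
  have "sqrt (gram A B C) / (1 + A + B + C) = sqrt R / k"
    using uvwpos unfolding g s by (simp add: real_sqrt_mult nz)
  also have "\<dots> \<le> sqrt 2 * (k / 5) / k"
  proof (rule divide_right_mono)
    show "sqrt R \<le> sqrt 2 * (k / 5)"
      using real_sqrt_le_mono[OF Rk] k by (simp add: real_sqrt_mult)
  qed (use k in simp)
  also have "\<dots> = sqrt 2 / 5"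
    using k by simp
  finally have q: "sqrt (gram A B C) / (1 + A + B + C) \<le> sqrt 2 / 5" .
  \<comment> \<open>Replacing \<open>arctan x\<close> by \<open>x\<close> loses little enough: 22
    times the resulting bound is about 12.45, still below \<open>4 * pi\<close>.\<close>
  have "arctan (sqrt (gram A B C) / (1 + A + B + C)) \<le> sqrt (gram A B C) / (1 + A + B + C)"
    using \<open>gram A B C > 0\<close> k uvwpos s by (intro arctan_le_self) simp
  moreover have "1 + A + B + C > 0"
    using k uvwpos s by simp
  ultimately show "spherical_angle A B C + spherical_angle B A C + spherical_angle C A B - pi
      \<le> 2 * sqrt 2 / 5"
    using spherical_excess_le[OF * \<open>gram A B C > 0\<close>] q by simp
qed

section \<open>Solid angles of ball tetrahedra\<close>

lemma mink_commute: "mink x y = mink y x"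
  by (simp add: mink_def inner_commute mult.commute)

lemma mink_diff_right: "mink x (y - z) = mink x y - mink x z"
  by (simp add: mink_def inner_diff_right algebra_simps)

lemma mink_scaleR_right: "mink x (c *\<^sub>R y) = c * mink x y"
  by (simp add: mink_def algebra_simps)

text \<open>\<open>perp w\<close> is the orthogonal projection along \<open>w\<close>, so one of the
  two projections may be dropped.\<close>

lemma mink_perp:
  assumes "mink w w \<noteq> 0"
  shows "mink (perp w x) (perp w y) = mink x y - mink w x * mink w y / mink w w"
proof -
  have ortho: "mink (perp w y) w = 0"
    unfolding mink_commute[of "perp w y" w] using assms
    by (simp add: perp_def mink_diff_right mink_scaleR_right mink_commute[of y w])
  have "mink (perp w x) (perp w y) = mink (perp w y) (x - (mink x w / mink w w) *\<^sub>R w)"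
    by (subst mink_commute) (simp only: perp_def[of w x])
  also have "\<dots> = mink x (perp w y)"
    by (simp add: mink_diff_right mink_scaleR_right ortho mink_commute[of x "perp w y"])
  also have "\<dots> = mink x y - mink w x * mink w y / mink w w"
    by (simp add: perp_def mink_diff_right mink_scaleR_right mink_commute[of x w]
        mink_commute[of y w] mult.commute)
  finally show ?thesis .
qed

text \<open>Reversed Cauchy-Schwarz gives \<open>- mink p q \<ge> 1\<close>, the range in which
  \<open>cosh\<close> undoes \<open>arcosh\<close>.\<close>

lemma H3_cosh_hdist:
  assumes "p \<in> H3" "q \<in> H3"
  shows "cosh (hdist p q) = - mink p q"
proof -
  define x y where "x = norm (snd p)" and "y = norm (snd q)"
  have p: "(fst p)\<^sup>2 = 1 + x\<^sup>2" "fst p > 0" and q: "(fst q)\<^sup>2 = 1 + y\<^sup>2" "fst q > 0"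
    using assms by (simp_all add: H3_def mink_def x_def y_def dot_square_norm power2_eq_square)
  have "(1 + x * y)\<^sup>2 \<le> (1 + x\<^sup>2) * (1 + y\<^sup>2)"
    using zero_le_power2[of "x - y"] by (simp add: power2_eq_square algebra_simps)
  also have "\<dots> = (fst p * fst q)\<^sup>2"
    by (simp add: p q power_mult_distrib)
  finally have "1 + x * y \<le> fst p * fst q"
    using p(2) q(2) by (auto intro: power2_le_imp_le)
  moreover have "snd p \<bullet> snd q \<le> x * y"
    unfolding x_def y_def by (rule norm_cauchy_schwarz)
  ultimately show ?thesis
    by (simp add: hdist_def mink_def cosh_arcosh_real)
qed

text \<open>For three directions with lengths \<open>x\<close>, \<open>y\<close>, \<open>z\<close>
  and angle cosines \<open>A\<close>, \<open>B\<close>, \<open>C\<close>, projecting along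
  \<open>X\<close> produces the entries of the spherical law of cosines, and the lengths
  cancel.\<close>

lemma mink_angle_perp:
  fixes X Y Z :: minkowski
  assumes "x > 0" "y > 0" "z > 0" "\<bar>B\<bar> < 1" "\<bar>C\<bar> < 1"
    and "mink X X = x\<^sup>2" "mink Y Y = y\<^sup>2" "mink Z Z = z\<^sup>2"
    and "mink X Y = x * y * C" "mink X Z = x * z * B" "mink Y Z = y * z * A"
  shows "mink_angle (perp X Y) (perp X Z) = spherical_angle A B C"
proof -
  have X: "mink X X \<noteq> 0"
    using assms by simp
  have "mink (perp X Y) (perp X Z) = y * z * (A - B * C)"
    "mink (perp X Y) (perp X Y) = y\<^sup>2 * (1 - C\<^sup>2)"
    "mink (perp X Z) (perp X Z) = z\<^sup>2 * (1 - B\<^sup>2)"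
    using assms by (simp_all add: mink_perp[OF X] power2_eq_square field_simps)
  then show ?thesis
    using assms by (simp add: mink_angle_def spherical_angle_def real_sqrt_mult mult_ac)
qed

text \<open>The last three hypotheses are the hyperbolic law of cosines in the faces at
  \<open>p\<close>, so \<open>A\<close>, \<open>B\<close>, \<open>C\<close> are the cosines of the
  face angles there. Only these enter, so every choice of tetrahedron gives the same value.\<close>

lemma solid_angle_at_eq:
  assumes "ball_tetrahedron a b c d (p, q, u, v)" "a > 0" "b > 0" "c > 0" "d > 0"
    and "\<bar>A\<bar> < 1" "\<bar>B\<bar> < 1" "\<bar>C\<bar> < 1"
    and C: "cosh (a + b) * cosh (a + c) - cosh (b + c) = sinh (a + b) * sinh (a + c) * C"
    and B: "cosh (a + b) * cosh (a + d) - cosh (b + d) = sinh (a + b) * sinh (a + d) * B"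
    and A: "cosh (a + c) * cosh (a + d) - cosh (c + d) = sinh (a + c) * sinh (a + d) * A"
  shows "solid_angle_at p q u v =
    spherical_angle A B C + spherical_angle B A C + spherical_angle C A B - pi"
proof -
  have H: "p \<in> H3" "q \<in> H3" "u \<in> H3" "v \<in> H3"
    and h: "hdist p q = a + b" "hdist p u = a + c" "hdist p v = a + d"
     "hdist q u = b + c" "hdist q v = b + d" "hdist u v = c + d"
    using assms(1) by (auto simp: ball_tetrahedron_def)
  have one: "mink x x = - 1" if "x \<in> H3" for x
    using that by (simp add: H3_def)
  have m: "mink p q = - cosh (a + b)" "mink p u = - cosh (a + c)" "mink p v = - cosh (a + d)"
     "mink q u = - cosh (b + c)" "mink q v = - cosh (b + d)" "mink u v = - cosh (c + d)"
    using H3_cosh_hdist H h by (metis minus_minus)+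
  define X Y Z where "X = perp p q" and "Y = perp p u" and "Z = perp p v"
  have pp: "mink p p \<noteq> 0"
    using one H by simp
  have sc: "cosh l * cosh l - 1 = (sinh l)\<^sup>2" for l :: real
    using cosh_square_eq[of l] by (simp add: power2_eq_square)
  have g: "mink X X = (sinh (a + b))\<^sup>2" "mink Y Y = (sinh (a + c))\<^sup>2" "mink Z Z = (sinh (a + d))\<^sup>2"
    "mink X Y = sinh (a + b) * sinh (a + c) * C"
    "mink X Z = sinh (a + b) * sinh (a + d) * B"
    "mink Y Z = sinh (a + c) * sinh (a + d) * A"
    unfolding X_def Y_def Z_def mink_perp[OF pp] using one H m A B C
    by (simp_all add: sc flip: sc)
  have sym: "mink Y X = mink X Y" "mink Z X = mink X Z" "mink Z Y = mink Y Z"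
    by (rule mink_commute)+
  have pos: "sinh (a + b) > 0" "sinh (a + c) > 0" "sinh (a + d) > 0"
    using assms by simp_all
  have "dihedral p q u v = spherical_angle A B C"
    unfolding dihedral_def X_def[symmetric] Y_def[symmetric] Z_def[symmetric]
    using pos assms(6-8) g by (intro mink_angle_perp)
  moreover have "dihedral p u q v = spherical_angle B A C"
    unfolding dihedral_def X_def[symmetric] Y_def[symmetric] Z_def[symmetric]
    using pos assms(6-8) g
    by (intro mink_angle_perp[where x = "sinh (a + c)" and y = "sinh (a + b)" and z = "sinh (a + d)"])
      (simp_all add: sym)
  moreover have "dihedral p v q u = spherical_angle C A B"
    unfolding dihedral_def X_def[symmetric] Y_def[symmetric] Z_def[symmetric]
    using pos assms(6-8) g
    by (intro mink_angle_perp[where x = "sinh (a + d)" and y = "sinh (a + b)" and z = "sinh (a + c)"])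
      (simp_all add: sym)
  ultimately show ?thesis
    by (simp add: solid_angle_at_def)
qed

text \<open>With \<open>p\<close> at the apex of the hyperboloid, the other vertices are reached by
  going the prescribed lengths in unit directions that enclose the prescribed face angles. The law
  of cosines then gives the opposite edges.\<close>

lemma ball_tetrahedron_exists:
  assumes "a > 0" "b > 0" "c > 0" "d > 0" "\<bar>C\<bar> < 1" "gram A B C > 0"
    and C: "cosh (a + b) * cosh (a + c) - cosh (b + c) = sinh (a + b) * sinh (a + c) * C"
    and B: "cosh (a + b) * cosh (a + d) - cosh (b + d) = sinh (a + b) * sinh (a + d) * B"
    and A: "cosh (a + c) * cosh (a + d) - cosh (c + d) = sinh (a + c) * sinh (a + d) * A"
  shows "\<exists>P. ball_tetrahedron a b c d P"
proof -
  define s where "s = sqrt (1 - C\<^sup>2)"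
  have s: "s > 0" "s\<^sup>2 = 1 - C\<^sup>2"
    using one_minus_square_pos[OF assms(5)] by (simp_all add: s_def)
  define g where "g = sqrt (gram A B C)"
  have g: "g > 0" "g\<^sup>2 = gram A B C"
    using assms by (simp_all add: g_def)
  \<comment> \<open>Rows of the Cholesky factor of the Gram matrix with off-diagonal entries
    \<open>C\<close>, \<open>B\<close>, \<open>A\<close>.\<close>
  define e f h :: "real^3" where "e = vector [1, 0, 0]" and "f = vector [C, s, 0]"
    and "h = vector [B, (A - B * C) / s, g / s]"
  have "B\<^sup>2 + ((A - B * C) / s)\<^sup>2 + (g / s)\<^sup>2 = 1"
  proof -
    have "(A - B * C)\<^sup>2 + g\<^sup>2 = s\<^sup>2 * (1 - B\<^sup>2)"
      unfolding s(2) g(2) gram_def by algebra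
    then show ?thesis
      using s(1) by (simp add: power_divide field_simps)
  qed
  then have ip: "e \<bullet> e = 1" "f \<bullet> f = 1" "h \<bullet> h = 1" "e \<bullet> f = C" "e \<bullet> h = B" "f \<bullet> h = A"
    using s by (simp_all add: e_def f_def h_def inner_vec_def sum_3 power2_eq_square)
  define p q u v :: minkowski where "p = (1, 0)"
    and "q = (cosh (a + b), sinh (a + b) *\<^sub>R e)"
    and "u = (cosh (a + c), sinh (a + c) *\<^sub>R f)"
    and "v = (cosh (a + d), sinh (a + d) *\<^sub>R h)"
  have sh: "sinh l * sinh l - cosh l * cosh l = - 1" for l :: real
    using cosh_square_eq[of l] by (simp add: power2_eq_square)
  have pos: "sinh (a + b) > 0" "sinh (a + c) > 0" "sinh (a + d) > 0"
    using assms by simp_all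
  have H: "{p, q, u, v} \<subseteq> H3"
    by (simp add: H3_def mink_def p_def q_def u_def v_def ip sh)
  have "- mink p q = cosh (a + b)" "- mink p u = cosh (a + c)" "- mink p v = cosh (a + d)"
     "- mink q u = cosh (b + c)" "- mink q v = cosh (b + d)" "- mink u v = cosh (c + d)"
    using A B C by (simp_all add: mink_def p_def q_def u_def v_def ip algebra_simps)
  then have h: "hdist p q = a + b" "hdist p u = a + c" "hdist p v = a + d"
     "hdist q u = b + c" "hdist q v = b + d" "hdist u v = c + d"
    using assms by (simp_all add: hdist_def arcosh_cosh_real)
  \<comment> \<open>By triangularity each further vertex leaves a coordinate hyperplane that
    contains the previous ones; for \<open>v\<close> this is where \<open>gram A B C > 0\<close>
    enters.\<close>
  have sub: "subspace {x :: minkowski. snd x $ n = 0}" for n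
    by (simp add: subspace_def)
  have "span {u, q, p} \<subseteq> {x. snd x $ 3 = 0}"
    by (rule span_minimal[OF _ sub]) (simp add: p_def q_def u_def e_def f_def)
  moreover have "snd v $ 3 \<noteq> 0"
    using s g pos by (simp add: v_def h_def)
  ultimately have 1: "v \<notin> span {u, q, p}"
    by auto
  have "span {q, p} \<subseteq> {x. snd x $ 2 = 0}"
    by (rule span_minimal[OF _ sub]) (simp add: p_def q_def e_def)
  moreover have "snd u $ 2 \<noteq> 0"
    using s pos by (simp add: u_def f_def)
  ultimately have 2: "u \<notin> span {q, p}"
    by auto
  have "span {p} \<subseteq> {x. snd x $ 1 = 0}"
    by (rule span_minimal[OF _ sub]) (simp add: p_def)
  moreover have "snd q $ 1 \<noteq> 0"
    using pos by (simp add: q_def e_def)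
  ultimately have 3: "q \<notin> span {p}"
    by auto
  have 4: "p \<noteq> 0"
    by (simp add: p_def zero_prod_def)
  have "v \<notin> {u, q, p}" "u \<notin> {q, p}" "q \<notin> {p}"
    using 1 2 3 span_base by metis+
  moreover from this 1 2 3 4 have "independent {v, u, q, p}"
    by (simp add: independent_insert)
  ultimately have "card {p, q, u, v} = 4" "independent {p, q, u, v}"
    by (auto simp: insert_commute)
  then have "ball_tetrahedron a b c d (p, q, u, v)"
    unfolding ball_tetrahedron_def using H h by simp
  then show ?thesis ..
qed

section \<open>Hyperbolic cotangents and the face angles of ball tetrahedra\<close>

lemma coth_add:
  assumes "a > 0" "b > 0"
  shows "coth a + coth b = sinh (a + b) / (sinh a * sinh b)"
  using assms by (simp add: coth_def sinh_add field_simps)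

lemma coth_square:
  assumes "a > 0"
  shows "(coth a)\<^sup>2 - 1 = 1 / (sinh a)\<^sup>2"
  using assms by (simp add: coth_def power_divide cosh_square_eq field_simps)

lemma coth_gt_1:
  assumes "a > 0"
  shows "coth a > 1"
  using assms by (simp add: coth_def sinh_less_cosh_real)

lemma coth_antimono:
  assumes "0 < b" "b \<le> a"
  shows "coth a \<le> coth b"
proof -
  have "sinh (a - b) \<ge> 0"
    using assms by simp
  then have "cosh a * sinh b \<le> cosh b * sinh a"
    by (simp add: sinh_diff mult.commute)
  then show ?thesis
    using assms by (simp add: coth_def field_simps)
qed

text \<open>Since \<open>(a + b) - (a + c) = b - c\<close>, the left side is
  \<open>sinh (a + b) * sinh (a + c) - 2 * sinh b * sinh c\<close>; the cotangents express the
  quotient of these two terms.\<close>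

lemma cosh_law:
  assumes "a > 0" "b > 0" "c > 0"
  shows "cosh (a + b) * cosh (a + c) - cosh (b + c) = sinh (a + b) * sinh (a + c) *
    (1 - 2 * ((coth a)\<^sup>2 - 1) / ((coth a + coth b) * (coth a + coth c)))"
proof -
  have ne: "sinh a \<noteq> 0" "sinh b \<noteq> 0" "sinh c \<noteq> 0" "sinh (a + b) \<noteq> 0" "sinh (a + c) \<noteq> 0"
    using assms by simp_all
  have "2 * ((coth a)\<^sup>2 - 1) / ((coth a + coth b) * (coth a + coth c))
      = 2 * (sinh b * sinh c) / (sinh (a + b) * sinh (a + c))"
    unfolding coth_square[OF assms(1)] coth_add[OF assms(1,2)] coth_add[OF assms(1,3)]
    using ne by (simp add: power2_eq_square)
  then have "sinh (a + b) * sinh (a + c) *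
      (1 - 2 * ((coth a)\<^sup>2 - 1) / ((coth a + coth b) * (coth a + coth c)))
      = sinh (a + b) * sinh (a + c) - 2 * (sinh b * sinh c)"
    using ne by (simp add: right_diff_distrib)
  also have "\<dots> = cosh (a + b) * cosh (a + c) - cosh (b + c)"
  proof -
    have "cosh ((a + b) - (a + c)) = cosh (b - c)"
      by simp
    then show ?thesis
      unfolding cosh_diff[of "a + b" "a + c"] cosh_diff[of b c] cosh_add[of b c] by simp
  qed
  finally show ?thesis ..
qed

text \<open>The largest radius has the smallest cotangent \<open>y\<close>, so each sum
  \<open>y + coth x\<close> is at least \<open>2 * y\<close>, hence at least \<open>2 * s\<close>.
  This places \<open>U\<close>, \<open>V\<close>, \<open>W\<close> in the range of the excess
  bound.\<close>

lemma solid_angle_le: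
  assumes "b > 0" "c > 0" "d > 0" "b \<le> a" "c \<le> a" "d \<le> a" "Qform a b c d > 0"
  shows "solid_angle a b c d \<le> 2 * sqrt 2 / 5"
proof -
  define y where "y = coth a"
  define s where "s = sqrt (y\<^sup>2 - 1)"
  define U V W where "U = (y + coth b) / s" and "V = (y + coth c) / s" and "W = (y + coth d) / s"
  have a: "a > 0"
    using assms by simp
  have y: "y > 1"
    unfolding y_def by (rule coth_gt_1[OF a])
  then have s: "s > 0" "s\<^sup>2 = y\<^sup>2 - 1"
    by (simp_all add: s_def)
  have "s \<le> y"
    using y s by (auto intro: power2_le_imp_le)
  have ge2: "(y + coth x) / s \<ge> 2" if "0 < x" "x \<le> a" for x
  proof -
    have "2 * s \<le> y + coth x"
      using coth_antimono[OF that] \<open>s \<le> y\<close> unfolding y_def by linarith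
    then show ?thesis
      using s(1) by (simp add: pos_le_divide_eq)
  qed
  have UVW: "U \<ge> 2" "V \<ge> 2" "W \<ge> 2"
    unfolding U_def V_def W_def using assms ge2 by blast+
  have "y + coth b = s * U" "y + coth c = s * V" "y + coth d = s * W"
    using s(1) by (simp_all add: U_def V_def W_def)
  \<comment> \<open>In terms of the sums \<open>y + coth x\<close>, positivity of
    \<open>Qform\<close> becomes, up to the factor \<open>s\<^sup>2\<close>, exactly the Gram
    condition on \<open>U\<close>, \<open>V\<close>, \<open>W\<close>.\<close>
  moreover have "Qform a b c d = 2 * ((y + coth b) * (y + coth c) + (y + coth c) * (y + coth d)
        + (y + coth d) * (y + coth b))
        - ((y + coth b)\<^sup>2 + (y + coth c)\<^sup>2 + (y + coth d)\<^sup>2) - 4 * s\<^sup>2"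
    unfolding Qform_def s(2) y_def[symmetric] by algebra
  ultimately have "Qform a b c d =
      s\<^sup>2 * (2 * (U * V + V * W + W * U) - (U\<^sup>2 + V\<^sup>2 + W\<^sup>2) - 4)"
    by (simp add: power2_eq_square algebra_simps)
  then have P: "2 * (U * V + V * W + W * U) - (U\<^sup>2 + V\<^sup>2 + W\<^sup>2) > 4"
    using assms(7) s(1) by (simp add: zero_less_mult_iff)
  define A B C where "A = 1 - 2 / (V * W)" and "B = 1 - 2 / (U * W)" and "C = 1 - 2 / (U * V)"
  note * = spherical_excess_le_const[OF UVW P, folded A_def B_def C_def]
  have frac: "1 - 2 / ((y + \<alpha>) / s * ((y + \<beta>) / s)) = 1 - 2 * (y\<^sup>2 - 1) / ((y + \<alpha>) * (y + \<beta>))"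
    for \<alpha> \<beta>
    unfolding s(2)[symmetric] by (simp add: power2_eq_square)
  have ABC: "cosh (a + b) * cosh (a + c) - cosh (b + c) = sinh (a + b) * sinh (a + c) * C"
    "cosh (a + b) * cosh (a + d) - cosh (b + d) = sinh (a + b) * sinh (a + d) * B"
    "cosh (a + c) * cosh (a + d) - cosh (c + d) = sinh (a + c) * sinh (a + d) * A"
    unfolding A_def B_def C_def U_def V_def W_def frac unfolding y_def
    by (intro cosh_law a assms)+
  \<comment> \<open>Existence is what makes the \<open>SOME\<close> in \<open>solid_angle\<close>
    denote an actual tetrahedron.\<close>
  have "\<exists>P. ball_tetrahedron a b c d P"
    using ball_tetrahedron_exists[OF a assms(1-3) *(3,4) ABC] .
  then have "ball_tetrahedron a b c d (SOME P. ball_tetrahedron a b c d P)"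
    by (rule someI_ex)
  moreover obtain p q u v where "(SOME P. ball_tetrahedron a b c d P) = (p, q, u, v)"
    by (metis prod_cases4)
  ultimately show ?thesis
    using solid_angle_at_eq[OF _ a assms(1-3) *(1-3) ABC] *(5) by (simp add: solid_angle_def)
qed

text \<open>At a vertex of largest radius \<open>coth a \<le> coth b\<close> excludes
  \<open>in_D a b c d\<close>, so a virtual tetrahedron contributes 0 there and never
  \<open>2 * pi\<close>.\<close>

lemma ext_solid_angle_le:
  assumes "b > 0" "c > 0" "d > 0" "b \<le> a" "c \<le> a" "d \<le> a"
  shows "ext_solid_angle a b c d \<le> 2 * sqrt 2 / 5"
proof -
  have y: "coth a \<le> coth b" "coth b > 1" "coth c > 1" "coth d > 1"
    using assms by (auto intro: coth_antimono coth_gt_1)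
  then have "0 \<le> sqrt (coth b * coth c + coth c * coth d + coth d * coth b + 1)"
    by simp
  then have "\<not> in_D a b c d"
    using y unfolding in_D_def by linarith
  then show ?thesis
    using solid_angle_le[OF assms] by (simp add: ext_solid_angle_def)
qed

section \<open>The maximum principle\<close>

lemma finite_attains_max:
  fixes f :: "'i \<Rightarrow> real"
  assumes "finite I" "I \<noteq> {}"
  obtains i where "i \<in> I" "\<And>j. j \<in> I \<Longrightarrow> f j \<le> f i"
proof -
  have "Max (f ` I) \<in> f ` I"
    using assms by (intro Max_in) auto
  then obtain i where "i \<in> I" "Max (f ` I) = f i"
    by auto
  then show ?thesis
    using that assms(1) by (metis Max_ge finite_imageI imageI)
qed

lemma ext_curvature_at_max_ge:
  assumes T: "\<Union>T = {1..N}" and deg: "tetra_degree T i \<le> 22"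
    and r: "ball_packing N r" and i: "i \<in> {1..N}" and max: "\<And>j. j \<in> {1..N} \<Longrightarrow> r j \<le> r i"
  shows "ext_curvature T r i \<ge> 4 * pi - 44 * sqrt 2 / 5"
proof -
  define I where "I = {(j, k, l). j < k \<and> k < l \<and> {i, j, k, l} \<in> tetrahedra T}"
  define f where "f = (\<lambda>(j, k, l). {i, j, k, l})"
  \<comment> \<open>Otherwise the set of the four vertices would have fewer than four
    elements.\<close>
  have ne: "j \<noteq> i" "k \<noteq> i" "l \<noteq> i" if "(j, k, l) \<in> I" for j k l
    using that by (auto simp: I_def tetrahedra_def card_insert_if split: if_splits)
  have "T \<subseteq> Pow {1..N}"
    using T by auto
  then have fin: "finite {\<sigma> \<in> tetrahedra T. i \<in> \<sigma>}"
    by (intro finite_subset[OF _ finite_Pow_iff[THEN iffD2, of "{1..N}"]])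
      (auto simp: tetrahedra_def)
  have "inj_on f I"
  proof (rule inj_onI)
    fix x x' assume x: "x \<in> I" "x' \<in> I" "f x = f x'"
    obtain j k l j' k' l' where jkl: "x = (j, k, l)" "x' = (j', k', l')"
      by (metis prod_cases3)
    have "f x - {i} = {j, k, l}" "f x' - {i} = {j', k', l'}"
      using ne x(1,2) unfolding jkl f_def by fastforce+
    then have "{j, k, l} = {j', k', l'}"
      using x(3) by simp
    \<comment> \<open>Sorting recovers the increasing triple from its set, so triples inject into
      the tetrahedra at \<open>i\<close>.\<close>
    moreover have "sorted_list_of_set {j, k, l} = [j, k, l]"
        "sorted_list_of_set {j', k', l'} = [j', k', l']"
      using x(1,2) sorted_list_of_set.idem_if_sorted_distinct[of "[j, k, l]"]
        sorted_list_of_set.idem_if_sorted_distinct[of "[j', k', l']"]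
      by (simp_all add: I_def jkl)
    ultimately have "[j, k, l] = [j', k', l']"
      by metis
    then show "x = x'"
      by (simp add: jkl)
  qed
  moreover have "f ` I \<subseteq> {\<sigma> \<in> tetrahedra T. i \<in> \<sigma>}"
    by (auto simp: I_def f_def)
  ultimately have "card I \<le> tetra_degree T i"
    unfolding tetra_degree_def using fin by (rule card_inj_on_le)
  then have card: "card I \<le> 22"
    using deg by simp
  have "ext_solid_angle (r i) (r j) (r k) (r l) \<le> 2 * sqrt 2 / 5" if "(j, k, l) \<in> I" for j k l
  proof -
    have "j \<in> {1..N}" "k \<in> {1..N}" "l \<in> {1..N}"
      using that T by (auto simp: I_def tetrahedra_def)
    then show ?thesis
      using r max by (intro ext_solid_angle_le) (auto simp: ball_packing_def)
  qed
  then have "(\<Sum>(j, k, l) \<in> I. ext_solid_angle (r i) (r j) (r k) (r l))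
      \<le> of_nat (card I) * (2 * sqrt 2 / 5)"
    by (intro sum_bounded_above) auto
  also have "\<dots> \<le> 22 * (2 * sqrt 2 / 5)"
    using card by (intro mult_right_mono) auto
  finally show ?thesis
    by (simp add: ext_curvature_def I_def)
qed

text \<open>A joint maximum over all indices and all times in \<open>{0..t}\<close> cannot occur at
  a positive time: the derivative there is negative, so slightly earlier values would be
  larger.\<close>

lemma finite_family_max_principle:
  fixes f f' :: "'i \<Rightarrow> real \<Rightarrow> real"
  assumes fin: "finite I"
    and deriv: "\<And>i t. i \<in> I \<Longrightarrow> t \<ge> 0 \<Longrightarrow>
      (f i has_real_derivative f' i t) (at t within {0..})"
    and neg: "\<And>i t. i \<in> I \<Longrightarrow> t \<ge> 0 \<Longrightarrow> (\<And>j. j \<in> I \<Longrightarrow> f j t \<le> f i t) \<Longrightarrow> f' i t < 0"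
    and j: "j \<in> I" and t: "t \<ge> 0"
  shows "\<exists>i\<in>I. f j t \<le> f i 0"
proof -
  have "\<exists>x\<in>{0..t}. \<forall>s\<in>{0..t}. f i s \<le> f i x" if "i \<in> I" for i
  proof (rule continuous_attains_sup)
    have "continuous_on {0..} (f i)"
      using deriv[OF that] by (intro DERIV_continuous_on) auto
    then show "continuous_on {0..t} (f i)"
      by (rule continuous_on_subset) auto
  qed (use t in auto)
  then obtain x where x: "\<And>i. i \<in> I \<Longrightarrow> x i \<in> {0..t}"
    and xmax: "\<And>i s. i \<in> I \<Longrightarrow> s \<in> {0..t} \<Longrightarrow> f i s \<le> f i (x i)"
    by metis
  obtain i where i: "i \<in> I" and imax: "\<And>k. k \<in> I \<Longrightarrow> f k (x k) \<le> f i (x i)"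
    using finite_attains_max[OF fin, of "\<lambda>k. f k (x k)"] j by blast
  have le: "f k s \<le> f i (x i)" if "k \<in> I" "s \<in> {0..t}" for k s
    using xmax[OF that] imax[OF that(1)] by simp
  have "x i = 0"
  proof (rule ccontr)
    assume "x i \<noteq> 0"
    then have xi: "x i > 0"
      using x[OF i] by simp
    have "f' i (x i) < 0"
      using neg[OF i, of "x i"] le x[OF i] by auto
    moreover have "(f i has_real_derivative f' i (x i)) (at (x i))"
    proof -
      have "at (x i) within {0..} = at (x i)"
        using xi by (intro at_within_interior) (simp add: interior_real_atLeast)
      then show ?thesis
        using deriv[OF i, of "x i"] xi by simp
    qed
    ultimately obtain \<epsilon> where e: "\<epsilon> > 0" "\<And>h. 0 < h \<Longrightarrow> h < \<epsilon> \<Longrightarrow> f i (x i) < f i (x i - h)"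
      using DERIV_neg_dec_left by blast
    \<comment> \<open>A step back that stays at nonnegative times and strictly below
      \<epsilon>.\<close>
    define h where "h = min (x i) (\<epsilon> / 2)"
    have "0 < h" "h < \<epsilon>" "x i - h \<in> {0..t}"
      using xi e(1) x[OF i] by (auto simp: h_def)
    then show False
      using e(2)[of h] le[OF i, of "x i - h"] by simp
  qed
  then show ?thesis
    using le[OF j, of t] t i by auto
qed

section \<open>Nonexistence of packings of zero curvature, and decay along the flow\<close>

theorem theorem1p5:
  fixes M :: "'a topology" and N :: nat and T :: "nat set set"
  assumes "closed_3_manifold M"
    and "triangulates N T M"
    and "\<And>i. i \<in> {1..N} \<Longrightarrow> tetra_degree T i \<le> 22"
  shows "(\<nexists>r. ball_packing N r \<and> (\<forall>i\<in>{1..N}. ext_curvature T r i = 0)) \<and>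
    (\<forall>r0 r. ball_packing N r0 \<and> ext_Yamabe_solution N T r \<and> (\<forall>i\<in>{1..N}. r 0 i = r0 i) \<longrightarrow>
      (\<forall>i\<in>{1..N}. ((\<lambda>t. r t i) \<longlongrightarrow> 0) at_top))"
proof -
  have T: "\<Union>T = {1..N}"
    using assms(2) by (simp add: triangulates_def)
  define c where "c = 4 * pi - 44 * sqrt 2 / 5"
  \<comment> \<open>These decimals suffice: \<open>44 * 1.42 / 5 = 12.496\<close>, while
    \<open>4 * 3.14 = 12.56\<close>.\<close>
  have "sqrt 2 < 1.42"
    by (rule real_less_lsqrt) (simp_all add: power2_eq_square)
  moreover have "pi > 3.14"
    using pi_approx by simp
  ultimately have c: "c > 0"
    by (simp add: c_def)
  have curv: "ext_curvature T r i \<ge> c"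
    if "ball_packing N r" "i \<in> {1..N}" "\<And>j. j \<in> {1..N} \<Longrightarrow> r j \<le> r i" for r i
    unfolding c_def using ext_curvature_at_max_ge[OF T assms(3)[OF that(2)] that] .
  \<comment> \<open>A vertex of largest radius requires a vertex at all: the manifold is nonempty,
    and the support of any point of the realization is a nonempty simplex.\<close>
  have "{1..N} \<noteq> {}"
  proof -
    have "topspace (realization N T) \<noteq> {}"
      using assms(1,2) homeomorphic_empty_space
      by (auto simp: closed_3_manifold_def triangulates_def)
    then obtain x where x: "{i. x i \<noteq> (0 :: real)} \<in> T"
      by (auto simp: realization_def)
    then have "{i. x i \<noteq> 0} \<noteq> {}"
      using assms(2) unfolding triangulates_def by metis
    then show ?thesis
      using x T by blast
  qed
  have no: "\<not> (ball_packing N r \<and> (\<forall>i\<in>{1..N}. ext_curvature T r i = 0))" for r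
  proof
    assume r: "ball_packing N r \<and> (\<forall>i\<in>{1..N}. ext_curvature T r i = 0)"
    obtain i where "i \<in> {1..N}" "\<And>j. j \<in> {1..N} \<Longrightarrow> r j \<le> r i"
      using finite_attains_max[OF finite_atLeastAtMost \<open>{1..N} \<noteq> {}\<close>, of r] by blast
    then have "ext_curvature T r i \<ge> c" "ext_curvature T r i = 0"
      using r curv[of r i] by blast+
    then show False
      using c by simp
  qed
  have flow: "((\<lambda>t. r t i) \<longlongrightarrow> 0) at_top"
    if sol: "ext_Yamabe_solution N T r" and i: "i \<in> {1..N}" for r i
  proof -
    \<comment> \<open>The common factor preserves which radius is largest. The rate
      \<open>c / 2\<close> instead of \<open>c\<close> leaves room for the strict inequality that
      the maximum principle demands.\<close>
    define f where "f = (\<lambda>i t. exp (c / 2 * t) * r t i)"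
    define f' where "f' = (\<lambda>i t. exp (c / 2 * t) * (c / 2 * r t i - ext_curvature T (r t) i * sinh (r t i)))"
    have pack: "ball_packing N (r t)" if "t \<ge> 0" for t
      using sol that by (simp add: ext_Yamabe_solution_def)
    have rpos: "r t j > 0" if "t \<ge> 0" "j \<in> {1..N}" for t j
      using pack[OF that(1)] that(2) by (simp add: ball_packing_def)
    have deriv: "(f j has_real_derivative f' j t) (at t within {0..})"
      if "j \<in> {1..N}" "t \<ge> 0" for j t
    proof -
      have "((\<lambda>s. r s j) has_real_derivative - ext_curvature T (r t) j * sinh (r t j))
          (at t within {0..})"
        using sol that by (simp add: ext_Yamabe_solution_def)
      then show ?thesis
        unfolding f_def f'_def
        by (auto intro!: derivative_eq_intros simp: algebra_simps)
    qed
    have neg: "f' j t < 0"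
      if j: "j \<in> {1..N}" and t: "t \<ge> 0" and max: "\<And>k. k \<in> {1..N} \<Longrightarrow> f k t \<le> f j t" for j t
    proof -
      have "r t k \<le> r t j" if "k \<in> {1..N}" for k
        using max[OF that] by (simp add: f_def)
      then have "c \<le> ext_curvature T (r t) j"
        using curv pack[OF t] j by simp
      have "c / 2 * r t j < c * r t j"
        using c rpos[OF t j] by simp
      \<comment> \<open>\<open>x \<le> sinh x\<close> for positive \<open>x\<close> turns the
        curvature bound into linear decay.\<close>
      also have "\<dots> \<le> c * sinh (r t j)"
        using real_le_x_sinh[of "r t j"] rpos[OF t j] c by (simp add: sinh_field_def exp_minus)
      also have "\<dots> \<le> ext_curvature T (r t) j * sinh (r t j)"
        using \<open>c \<le> _\<close> rpos[OF t j] by (intro mult_right_mono) auto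
      finally show ?thesis
        by (simp add: f'_def mult_less_0_iff)
    qed
    \<comment> \<open>As the radii are positive, the sum dominates every initial value, which gives
      one constant for all \<open>t\<close>.\<close>
    define K where "K = (\<Sum>j\<in>{1..N}. f j 0)"
    have le: "r t i \<le> K * exp (- c / 2 * t)" if t: "t \<ge> 0" for t
    proof -
      obtain j where j: "j \<in> {1..N}" "f i t \<le> f j 0"
        using finite_family_max_principle[where f = f and f' = f' and j = i and t = t,
            OF finite_atLeastAtMost deriv neg i t] by blast
      have "f j 0 \<le> K"
        unfolding K_def using j(1) rpos[of 0] by (intro member_le_sum) (auto simp: f_def less_imp_le)
      then have "exp (c / 2 * t) * r t i \<le> K"
        using j(2) by (simp add: f_def)
      then show ?thesis
        by (simp add: exp_minus field_simps)
    qed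
    have "eventually (\<lambda>t. 0 \<le> r t i) at_top"
      using eventually_ge_at_top[of 0] by (rule eventually_mono) (rule less_imp_le[OF rpos[OF _ i]])
    moreover have "eventually (\<lambda>t. r t i \<le> K * exp (- c / 2 * t)) at_top"
      using eventually_ge_at_top[of 0] by (rule eventually_mono) (rule le)
    moreover have "((\<lambda>t. K * exp (- c / 2 * t)) \<longlongrightarrow> 0) at_top"
    proof -
      have "filterlim (\<lambda>t. c / 2 * t) at_top at_top"
        using c by (intro filterlim_tendsto_pos_mult_at_top[OF tendsto_const] filterlim_ident) simp
      then have "filterlim (\<lambda>t. - c / 2 * t) at_bot at_top"
        by (simp add: filterlim_uminus_at_bot)
      then show ?thesis
        by (intro tendsto_mult_right_zero filterlim_compose[OF exp_at_bot])
    qed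
    ultimately show ?thesis
      by (rule tendsto_sandwich[OF _ _ tendsto_const])
  qed
  show ?thesis
    using no flow by blast
qed

end
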